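(* Let $\mathcal{M}=\mathcal{M}(G;U,\rho,\tau)$ and $\widetilde{\mathcal{M}}=\mathcal{M}(\widetilde G;\widetilde U,\widetilde\rho,\widetilde\tau)$ be two algebraic maps. Then $\mathcal{M}\cong\widetilde{\mathcal{M}}$ if and only if there exists a group isomorphism $\sigma:G\to\widetilde G$ such that, for some $\widetilde y\in\widetilde G$, \[U^\sigma=\widetilde y^{-1}\widetilde U\widetilde y,\qquad \rho^\sigma=\widetilde\rho,\qquad \tau^\sigma=\widetilde\tau.\]
   Context: An algebraic map $\mathcal{M}(G;U,\rho,\tau)$ consists of a group $G=\langle\rho,\tau\rangle$ with $\tau^2=1$ and a subgroup $U\le G$ such that the permutation representation of $G$ on the set $[G:U]$ of right cosets of $U$ (given by $(Ux)^a=Uxa$) is faithful. Two such maps $\mathcal{M}(G;U,\rho,\tau)$ and $\mathcal{M}(\widetilde G;\widetilde U,\widetilde\rho,\widetilde\tau)$ are isomorphic if there is a bijection $\mu:[G:U]\to[\widetilde G:\widetilde U]$ such that $(Ux)^{\mu\widetilde\rho}=(Ux)^{\rho\mu}$ and $(Ux)^{\mu\widetilde\tau}=(Ux)^{\tau\mu}$ for all $x\in G$ (maps composed left to right). *)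

theory Defs
  imports "HOL-Algebra.Coset" "HOL-Algebra.Generated_Groups"
begin

definition coset_perm :: "('a, 'c) monoid_scheme \<Rightarrow> 'a set \<Rightarrow> 'a \<Rightarrow> 'a set \<Rightarrow> 'a set"
  where "coset_perm G U a = (\<lambda>X \<in> rcosets\<^bsub>G\<^esub> U. X #>\<^bsub>G\<^esub> a)"

lemma (in group) coset_perm_rcoset:
  assumes "subgroup U G" "x \<in> carrier G" "a \<in> carrier G"
  shows "coset_perm G U a (U #> x) = U #> (x \<otimes> a)"
  using assms by (simp add: coset_perm_def coset_mult_assoc rcosetsI subgroup.subset)

(* The action is a right action, so coset_perm is an anti-homomorphism into BijGroup (which
   composes right to left) and the library's faithful_action does not apply to it directly.
   Injectivity means what it should because coset_perm is extensional on the cosets. *)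
locale algebraic_map = group G for G (structure) +
  fixes U :: "'a set" and \<rho> :: 'a and \<tau> :: 'a
  assumes subgroup_U: "subgroup U G"
    and rho_closed: "\<rho> \<in> carrier G"
    and tau_closed: "\<tau> \<in> carrier G"
    and generated: "generate G {\<rho>, \<tau>} = carrier G"
    and tau_square: "\<tau> [^] (2::nat) = \<one>"
    and faithful: "inj_on (coset_perm G U) (carrier G)"

definition map_isomorphic ::
  "('a, 'c) monoid_scheme \<Rightarrow> 'a set \<Rightarrow> 'a \<Rightarrow> 'a \<Rightarrow>
   ('b, 'd) monoid_scheme \<Rightarrow> 'b set \<Rightarrow> 'b \<Rightarrow> 'b \<Rightarrow> bool"
  where "map_isomorphic G U \<rho> \<tau> G' U' \<rho>' \<tau>' \<longleftrightarrow>
    (\<exists>\<mu>. bij_betw \<mu> (rcosets\<^bsub>G\<^esub> U) (rcosets\<^bsub>G'\<^esub> U') \<and>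
      (\<forall>x \<in> carrier G.
        coset_perm G' U' \<rho>' (\<mu> (U #>\<^bsub>G\<^esub> x)) = \<mu> (coset_perm G U \<rho> (U #>\<^bsub>G\<^esub> x)) \<and>
        coset_perm G' U' \<tau>' (\<mu> (U #>\<^bsub>G\<^esub> x)) = \<mu> (coset_perm G U \<tau> (U #>\<^bsub>G\<^esub> x))))"

end

(* Let S be the set of pairs (g, g') in G x G' such that \<mu> carries the action of g to that of g'.
   It is a subgroup of the direct product containing (\<rho>, \<rho>') and (\<tau>, \<tau>'), so it projects onto
   both factors; faithfulness makes both projections injective, hence S is the graph of an
   isomorphism \<sigma>. If \<mu> U = U' y, then \<sigma> maps U, the stabilizer of the coset U, onto the
   stabilizer of U' y, which is the conjugate of U' by y. Conversely, \<sigma> and y give the bijection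
   \<mu> X = y \<sigma>(X), which maps U x to U' y \<sigma>(x). *)

theory Submission
  imports Defs
begin

section \<open>Relations that are graphs of isomorphisms\<close>

text \<open>With both projections bijective, \<open>S\<close> is the graph of \<open>snd\<close>
  composed with the inverse of \<open>fst\<close>; closure under componentwise products is then
  exactly multiplicativity of this function. The second conclusion allows membership in
  \<open>S\<close> to be read off as a value of \<sigma>.\<close>

lemma iso_of_bijective_projections:
  fixes G :: "('a, 'c) monoid_scheme" and H :: "('b, 'd) monoid_scheme"
  assumes mult: "\<And>g g' h h'. (g, g') \<in> S \<Longrightarrow> (h, h') \<in> S \<Longrightarrow> (g \<otimes>\<^bsub>G\<^esub> h, g' \<otimes>\<^bsub>H\<^esub> h') \<in> S"
    and fst: "bij_betw fst S (carrier G)"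
    and snd: "bij_betw snd S (carrier H)"
  obtains \<sigma> where "\<sigma> \<in> iso G H" "\<And>g g'. (g, g') \<in> S \<longleftrightarrow> g \<in> carrier G \<and> \<sigma> g = g'"
proof -
  define \<sigma> where "\<sigma> = snd \<circ> inv_into S fst"
  have in_S: "(g, \<sigma> g) \<in> S" if "g \<in> carrier G" for g
  proof -
    have "inv_into S fst g \<in> S" "fst (inv_into S fst g) = g"
      using fst that by (auto simp: bij_betw_def inv_into_into f_inv_into_f)
    then show ?thesis
      by (metis \<sigma>_def comp_apply prod.collapse)
  qed
  have fun_S: "\<sigma> g = g'" if "(g, g') \<in> S" for g g'
  proof -
    have "g \<in> carrier G"
      using fst that by (force simp: bij_betw_def)
    then have "(g, \<sigma> g) = (g, g')"
      using inj_onD[OF bij_betw_imp_inj_on[OF fst], of "(g, \<sigma> g)" "(g, g')"] in_S that by simp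
    then show ?thesis by simp
  qed
  have graph: "(g, g') \<in> S \<longleftrightarrow> g \<in> carrier G \<and> \<sigma> g = g'" for g g'
    using in_S fun_S fst by (force simp: bij_betw_def)
  have bij: "bij_betw \<sigma> (carrier G) (carrier H)"
    unfolding \<sigma>_def using bij_betw_trans[OF bij_betw_inv_into[OF fst] snd] .
  have "\<sigma> \<in> hom G H"
    using bij mult in_S fun_S by (intro homI) (auto simp: bij_betw_def)
  with bij graph show thesis
    by (intro that) (auto simp: iso_def)
qed

section \<open>Equality of right cosets and conjugate subgroups\<close>

lemma (in group) rcos_eq_iff:
  assumes "subgroup U G" "x \<in> carrier G" "y \<in> carrier G"
  shows "U #> x = U #> y \<longleftrightarrow> x \<otimes> inv y \<in> U"
proof
  assume "U #> x = U #> y"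
  then have "x \<in> U #> y"
    using assms rcos_self by blast
  then show "x \<otimes> inv y \<in> U"
    using subgroup.rcos_module_imp[OF assms(1) is_group assms(3)] by blast
next
  assume "x \<otimes> inv y \<in> U"
  then have "x \<in> U #> y"
    using subgroup.rcos_module_rev[OF assms(1) is_group assms(3,2)] by blast
  then show "U #> x = U #> y"
    using repr_independence assms by metis
qed

text \<open>For a subgroup \<open>U\<close>, the right-hand side is what \<open>rcos_eq_iff\<close>
  yields for U y g = U y. Together the two lemmas identify the stabilizer of the coset U y with the
  conjugate of \<open>U\<close> by \<open>y\<close>.\<close>

lemma (in group) mem_conjugate_iff:
  assumes "U \<subseteq> carrier G" "y \<in> carrier G" "g \<in> carrier G"
  shows "g \<in> inv y <# U #> y \<longleftrightarrow> y \<otimes> g \<otimes> inv y \<in> U"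
proof
  assume "g \<in> inv y <# U #> y"
  then obtain u where u: "u \<in> U" "g = inv y \<otimes> u \<otimes> y"
    by (auto simp: l_coset_def r_coset_def)
  then have "y \<otimes> g \<otimes> inv y = u"
    using assms by (auto simp: m_assoc subset_iff) (simp add: m_assoc[symmetric] subset_iff)
  with u show "y \<otimes> g \<otimes> inv y \<in> U" by simp
next
  assume "y \<otimes> g \<otimes> inv y \<in> U"
  moreover have "g = inv y \<otimes> (y \<otimes> g \<otimes> inv y) \<otimes> y"
    using assms by (simp add: m_assoc) (simp add: m_assoc[symmetric])
  ultimately show "g \<in> inv y <# U #> y"
    by (auto simp: l_coset_def r_coset_def)
qed

section \<open>The right action of a map's group on the cosets\<close>

context algebraic_map
begin

lemma rcosets_act_closed:
  assumes "X \<in> rcosets U" "g \<in> carrier G"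
  shows "X #> g \<in> rcosets U"
  using assms subgroup.subset[OF subgroup_U]
  by (auto simp: RCOSETS_def coset_mult_assoc)

lemma rcosets_act_mult:
  assumes "X \<in> rcosets U" "g \<in> carrier G" "h \<in> carrier G"
  shows "X #> g #> h = X #> (g \<otimes> h)"
  using assms subgroup.rcosets_carrier[OF subgroup_U is_group] by (intro coset_mult_assoc) auto

lemma rcosets_act_one:
  assumes "X \<in> rcosets U"
  shows "X #> \<one> = X"
  using assms subgroup.rcosets_carrier[OF subgroup_U is_group] by (intro coset_mult_one) auto

text \<open>Two functions \<open>coset_perm G U g\<close> and \<open>coset_perm G U h\<close> that
  agree on the cosets are equal, both being restricted to the cosets, so the injectivity in
  \<open>faithful\<close> applies.\<close>

lemma act_faithful:
  assumes "g \<in> carrier G" "h \<in> carrier G" "\<And>X. X \<in> rcosets U \<Longrightarrow> X #> g = X #> h"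
  shows "g = h"
  using inj_onD[OF faithful] assms by (auto simp: coset_perm_def intro!: restrict_ext)

text \<open>The form in which generation is used: a projection of a subgroup of the direct product
  is onto once its image contains both generators.\<close>

lemma carrier_subset_of_subgroup:
  assumes "subgroup K G" "\<rho> \<in> K" "\<tau> \<in> K"
  shows "carrier G \<subseteq> K"
  using generate_subgroup_incl[OF _ assms(1), of "{\<rho>, \<tau>}"] assms generated by simp

end

section \<open>Map isomorphisms as equivariant bijections of cosets\<close>

text \<open>Since \<mu> sends cosets to cosets, \<open>coset_perm\<close> is only evaluated where it
  is right multiplication, and letting \<open>x\<close> run over the group lets U x run over all
  cosets.\<close>

lemma map_isomorphic_iff_equivariant:
  fixes G :: "('a, 'c) monoid_scheme" and H :: "('b, 'd) monoid_scheme"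
  assumes "algebraic_map G U \<rho> \<tau>" and "algebraic_map H V \<rho>' \<tau>'"
  shows "map_isomorphic G U \<rho> \<tau> H V \<rho>' \<tau>' \<longleftrightarrow>
    (\<exists>\<mu>. bij_betw \<mu> (rcosets\<^bsub>G\<^esub> U) (rcosets\<^bsub>H\<^esub> V) \<and>
      (\<forall>X \<in> rcosets\<^bsub>G\<^esub> U. \<mu> (X #>\<^bsub>G\<^esub> \<rho>) = \<mu> X #>\<^bsub>H\<^esub> \<rho>' \<and> \<mu> (X #>\<^bsub>G\<^esub> \<tau>) = \<mu> X #>\<^bsub>H\<^esub> \<tau>'))"
proof -
  have "(\<forall>x \<in> carrier G.
        coset_perm H V \<rho>' (\<mu> (U #>\<^bsub>G\<^esub> x)) = \<mu> (coset_perm G U \<rho> (U #>\<^bsub>G\<^esub> x)) \<and>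
        coset_perm H V \<tau>' (\<mu> (U #>\<^bsub>G\<^esub> x)) = \<mu> (coset_perm G U \<tau> (U #>\<^bsub>G\<^esub> x)))
    \<longleftrightarrow> (\<forall>X \<in> rcosets\<^bsub>G\<^esub> U. \<mu> (X #>\<^bsub>G\<^esub> \<rho>) = \<mu> X #>\<^bsub>H\<^esub> \<rho>' \<and> \<mu> (X #>\<^bsub>G\<^esub> \<tau>) = \<mu> X #>\<^bsub>H\<^esub> \<tau>')"
    if bij: "bij_betw \<mu> (rcosets\<^bsub>G\<^esub> U) (rcosets\<^bsub>H\<^esub> V)" for \<mu>
  proof -
    have "coset_perm H V h (\<mu> (U #>\<^bsub>G\<^esub> x)) = \<mu> (coset_perm G U g (U #>\<^bsub>G\<^esub> x))
        \<longleftrightarrow> \<mu> (U #>\<^bsub>G\<^esub> x #>\<^bsub>G\<^esub> g) = \<mu> (U #>\<^bsub>G\<^esub> x) #>\<^bsub>H\<^esub> h" if "x \<in> carrier G" for x g h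
    proof -
      have "U #>\<^bsub>G\<^esub> x \<in> rcosets\<^bsub>G\<^esub> U"
        using that by (auto simp: RCOSETS_def)
      then show ?thesis
        using bij_betw_apply[OF bij] by (auto simp: coset_perm_def)
    qed
    then show ?thesis
      by (auto simp: RCOSETS_def)
  qed
  then show ?thesis
    unfolding map_isomorphic_def by blast
qed

section \<open>From an equivariant bijection to a group isomorphism\<close>

lemma iso_of_equivariant:
  fixes G :: "('a, 'c) monoid_scheme" and H :: "('b, 'd) monoid_scheme"
  assumes "algebraic_map G U \<rho> \<tau>" and "algebraic_map H V \<rho>' \<tau>'"
    and bij: "bij_betw \<mu> (rcosets\<^bsub>G\<^esub> U) (rcosets\<^bsub>H\<^esub> V)"
    and rho: "\<And>X. X \<in> rcosets\<^bsub>G\<^esub> U \<Longrightarrow> \<mu> (X #>\<^bsub>G\<^esub> \<rho>) = \<mu> X #>\<^bsub>H\<^esub> \<rho>'"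
    and tau: "\<And>X. X \<in> rcosets\<^bsub>G\<^esub> U \<Longrightarrow> \<mu> (X #>\<^bsub>G\<^esub> \<tau>) = \<mu> X #>\<^bsub>H\<^esub> \<tau>'"
  obtains \<sigma> y where "\<sigma> \<in> iso G H" "y \<in> carrier H"
    "\<sigma> ` U = inv\<^bsub>H\<^esub> y <#\<^bsub>H\<^esub> V #>\<^bsub>H\<^esub> y" "\<sigma> \<rho> = \<rho>'" "\<sigma> \<tau> = \<tau>'"
proof -
  interpret G: algebraic_map G U \<rho> \<tau> by fact
  interpret H: algebraic_map H V \<rho>' \<tau>' by fact
  have \<mu>_closed: "\<mu> X \<in> rcosets\<^bsub>H\<^esub> V" if "X \<in> rcosets\<^bsub>G\<^esub> U" for X
    using bij_betw_apply[OF bij that] .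
  have \<mu>_onto: "\<exists>X \<in> rcosets\<^bsub>G\<^esub> U. Y = \<mu> X" if "Y \<in> rcosets\<^bsub>H\<^esub> V" for Y
    using bij that by (auto simp: bij_betw_def)
  have \<mu>_inj: "X = Y" if "X \<in> rcosets\<^bsub>G\<^esub> U" "Y \<in> rcosets\<^bsub>G\<^esub> U" "\<mu> X = \<mu> Y" for X Y
    using bij that by (auto simp: bij_betw_def dest: inj_onD)
  define S where "S = {(g, g') \<in> carrier G \<times> carrier H.
    \<forall>X \<in> rcosets\<^bsub>G\<^esub> U. \<mu> (X #>\<^bsub>G\<^esub> g) = \<mu> X #>\<^bsub>H\<^esub> g'}"
  have one: "(\<one>\<^bsub>G\<^esub>, \<one>\<^bsub>H\<^esub>) \<in> S"
    by (simp add: S_def G.rcosets_act_one H.rcosets_act_one \<mu>_closed)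
  have mult: "(g \<otimes>\<^bsub>G\<^esub> h, g' \<otimes>\<^bsub>H\<^esub> h') \<in> S" if "(g, g') \<in> S" "(h, h') \<in> S" for g g' h h'
    using that
    by (auto simp: S_def G.rcosets_act_closed \<mu>_closed
        G.rcosets_act_mult[symmetric] H.rcosets_act_mult[symmetric])
  have inv: "(inv\<^bsub>G\<^esub> g, inv\<^bsub>H\<^esub> g') \<in> S" if "(g, g') \<in> S" for g g'
  proof -
    have gg: "g \<in> carrier G" "g' \<in> carrier H"
      using that by (auto simp: S_def)
    have "\<mu> (X #>\<^bsub>G\<^esub> inv\<^bsub>G\<^esub> g) = \<mu> X #>\<^bsub>H\<^esub> inv\<^bsub>H\<^esub> g'" if X: "X \<in> rcosets\<^bsub>G\<^esub> U" for X
    proof -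
      \<comment> \<open>The relation for (g, g') is applied to the coset Y = X g^-1, where it reads
        \<mu>(X) = \<mu>(Y) g'; multiplying by the inverse of g' gives the claim.\<close>
      let ?Y = "X #>\<^bsub>G\<^esub> inv\<^bsub>G\<^esub> g"
      have Y: "?Y \<in> rcosets\<^bsub>G\<^esub> U"
        using X gg by (simp add: G.rcosets_act_closed)
      have "?Y #>\<^bsub>G\<^esub> g = X"
        using X gg by (simp add: G.rcosets_act_mult G.rcosets_act_one)
      then have "\<mu> X = \<mu> ?Y #>\<^bsub>H\<^esub> g'"
        using \<open>(g, g') \<in> S\<close> Y by (auto simp: S_def)
      then show ?thesis
        using \<mu>_closed[OF Y] gg by (simp add: H.rcosets_act_mult H.rcosets_act_one)
    qed
    then show ?thesis
      using gg by (simp add: S_def)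
  qed
  have gens: "(\<rho>, \<rho>') \<in> S" "(\<tau>, \<tau>') \<in> S"
    using rho tau
    by (simp_all add: S_def G.rho_closed G.tau_closed H.rho_closed H.tau_closed)
  have fst: "bij_betw fst S (carrier G)"
  proof (rule bij_betw_imageI)
    show "inj_on fst S"
    proof (rule inj_onI, clarsimp)
      fix g a b assume ab: "(g, a) \<in> S" "(g, b) \<in> S"
      \<comment> \<open>Surjectivity of \<mu> enters here: \<open>a\<close> and \<open>b\<close> act
        alike on every \<mu>(X), both giving \<mu>(X g), hence on every coset of
        \<open>V\<close>.\<close>
      have "Y #>\<^bsub>H\<^esub> a = Y #>\<^bsub>H\<^esub> b" if "Y \<in> rcosets\<^bsub>H\<^esub> V" for Y
        using \<mu>_onto[OF that] ab by (fastforce simp: S_def)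
      then show "a = b"
        using ab by (intro H.act_faithful) (auto simp: S_def)
    qed
    have "subgroup (fst ` S) G"
    proof (rule G.subgroupI)
      show "fst ` S \<subseteq> carrier G" by (auto simp: S_def)
      show "fst ` S \<noteq> {}" using one by auto
    qed (use inv mult in \<open>force+\<close>)
    then have "carrier G \<subseteq> fst ` S"
      by (rule G.carrier_subset_of_subgroup) (use gens in \<open>auto intro: rev_image_eqI\<close>)
    then show "fst ` S = carrier G"
      by (auto simp: S_def)
  qed
  have snd: "bij_betw snd S (carrier H)"
  proof (rule bij_betw_imageI)
    show "inj_on snd S"
    proof (rule inj_onI, clarsimp)
      fix g a b assume ab: "(a, g) \<in> S" "(b, g) \<in> S"
      \<comment> \<open>Here injectivity of \<mu> is what counts: \<mu>(X a) and \<mu>(X b) both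
        equal \<mu>(X) g.\<close>
      have "X #>\<^bsub>G\<^esub> a = X #>\<^bsub>G\<^esub> b" if "X \<in> rcosets\<^bsub>G\<^esub> U" for X
        using ab that by (intro \<mu>_inj G.rcosets_act_closed) (auto simp: S_def)
      then show "a = b"
        using ab by (intro G.act_faithful) (auto simp: S_def)
    qed
    have "subgroup (snd ` S) H"
    proof (rule H.subgroupI)
      show "snd ` S \<subseteq> carrier H" by (auto simp: S_def)
      show "snd ` S \<noteq> {}" using one by auto
    qed (use inv mult in \<open>force+\<close>)
    then have "carrier H \<subseteq> snd ` S"
      by (rule H.carrier_subset_of_subgroup) (use gens in \<open>auto intro: rev_image_eqI\<close>)
    then show "snd ` S = carrier H"
      by (auto simp: S_def)
  qed
  obtain \<sigma> where iso: "\<sigma> \<in> iso G H"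
    and graph: "\<And>g g'. (g, g') \<in> S \<longleftrightarrow> g \<in> carrier G \<and> \<sigma> g = g'"
    using iso_of_bijective_projections[OF mult fst snd] by blast
  have \<sigma>_onto: "\<sigma> ` carrier G = carrier H"
    using iso by (auto simp: iso_def bij_betw_def)
  have U_coset: "U \<in> rcosets\<^bsub>G\<^esub> U"
    using subgroup.subgroup_in_rcosets[OF G.subgroup_U G.is_group] .
  \<comment> \<open>The conjugating element is any representative of the image of the trivial coset
    \<open>U\<close>.\<close>
  obtain y where y: "y \<in> carrier H" "\<mu> U = V #>\<^bsub>H\<^esub> y"
    using \<mu>_closed[OF U_coset] by (auto simp: RCOSETS_def)
  have V_sub: "V \<subseteq> carrier H" and U_sub: "U \<subseteq> carrier G"
    using H.subgroup_U G.subgroup_U by (auto dest: subgroup.subset)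
  \<comment> \<open>Stabilizers are compared: \<open>g\<close> fixes \<open>U\<close> iff
    \<sigma>(g) fixes \<mu>(U) = V y, because \<mu> is injective and the pair (g, \<sigma>(g)) lies
    in \<open>S\<close>.\<close>
  have stab: "g \<in> U \<longleftrightarrow> \<sigma> g \<in> inv\<^bsub>H\<^esub> y <#\<^bsub>H\<^esub> V #>\<^bsub>H\<^esub> y" if g: "g \<in> carrier G" for g
  proof -
    have \<sigma>g: "\<sigma> g \<in> carrier H"
      using g \<sigma>_onto by blast
    have "g \<in> U \<longleftrightarrow> U #>\<^bsub>G\<^esub> g = U"
      using g G.coset_join1 G.coset_join2 G.subgroup_U by blast
    also have "\<dots> \<longleftrightarrow> \<mu> (U #>\<^bsub>G\<^esub> g) = \<mu> U"
      using \<mu>_inj G.rcosets_act_closed U_coset g by metis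
    also have "\<mu> (U #>\<^bsub>G\<^esub> g) = V #>\<^bsub>H\<^esub> (y \<otimes>\<^bsub>H\<^esub> \<sigma> g)"
      using graph[of g "\<sigma> g"] g U_coset y \<sigma>g V_sub by (simp add: S_def H.coset_mult_assoc)
    also have "V #>\<^bsub>H\<^esub> (y \<otimes>\<^bsub>H\<^esub> \<sigma> g) = \<mu> U \<longleftrightarrow> \<sigma> g \<in> inv\<^bsub>H\<^esub> y <#\<^bsub>H\<^esub> V #>\<^bsub>H\<^esub> y"
      using y \<sigma>g V_sub H.subgroup_U by (simp add: H.rcos_eq_iff H.mem_conjugate_iff)
    finally show ?thesis .
  qed
  \<comment> \<open>This gives every element of the conjugate a preimage under \<sigma>, which
    \<open>stab\<close> then places in \<open>U\<close>.\<close>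
  have K_sub: "inv\<^bsub>H\<^esub> y <#\<^bsub>H\<^esub> V #>\<^bsub>H\<^esub> y \<subseteq> carrier H"
    using y V_sub by (simp add: H.l_coset_subset_G H.r_coset_subset_G)
  have "\<sigma> ` U = inv\<^bsub>H\<^esub> y <#\<^bsub>H\<^esub> V #>\<^bsub>H\<^esub> y" (is "_ = ?K")
  proof
    show "\<sigma> ` U \<subseteq> ?K"
    proof (rule image_subsetI)
      fix g assume g: "g \<in> U"
      show "\<sigma> g \<in> ?K"
        using iffD1[OF stab[OF subsetD[OF U_sub g]] g] .
    qed
    show "?K \<subseteq> \<sigma> ` U"
    proof
      fix k assume k: "k \<in> ?K"
      then have "k \<in> \<sigma> ` carrier G"
        unfolding \<sigma>_onto using subsetD[OF K_sub] by simp
      then obtain g where g: "g \<in> carrier G" "k = \<sigma> g"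
        by (rule imageE)
      then have "g \<in> U"
        using stab[OF g(1)] k by simp
      then show "k \<in> \<sigma> ` U"
        by (simp add: g(2))
    qed
  qed
  moreover have "\<sigma> \<rho> = \<rho>'" "\<sigma> \<tau> = \<tau>'"
    using gens unfolding graph by simp_all
  ultimately show thesis
    using that iso y(1) by blast
qed

section \<open>From a group isomorphism back to an equivariant bijection\<close>

text \<open>Applying \<sigma> turns right multiplication by \<open>g\<close> into right
  multiplication by \<sigma>(g), and left multiplication by \<open>y\<close> commutes with the
  latter. The factor \<open>y\<close> is there to turn the conjugate of \<open>V\<close> into the
  coset V y.\<close>

lemma equivariant_of_iso:
  fixes G :: "('a, 'c) monoid_scheme" and H :: "('b, 'd) monoid_scheme"
  assumes "group G" "group H" and U: "subgroup U G" and V: "subgroup V H"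
    and iso: "\<sigma> \<in> iso G H" and y: "y \<in> carrier H"
    and conj: "\<sigma> ` U = inv\<^bsub>H\<^esub> y <#\<^bsub>H\<^esub> V #>\<^bsub>H\<^esub> y"
  obtains \<mu> where "bij_betw \<mu> (rcosets\<^bsub>G\<^esub> U) (rcosets\<^bsub>H\<^esub> V)"
    "\<And>X g. X \<in> rcosets\<^bsub>G\<^esub> U \<Longrightarrow> g \<in> carrier G \<Longrightarrow> \<mu> (X #>\<^bsub>G\<^esub> g) = \<mu> X #>\<^bsub>H\<^esub> \<sigma> g"
proof -
  interpret G: group G by fact
  interpret H: group H by fact
  have hom: "\<sigma> \<in> hom G H" and bij: "bij_betw \<sigma> (carrier G) (carrier H)"
    using iso by (auto simp: iso_def)
  have closed: "\<sigma> g \<in> carrier H" if "g \<in> carrier G" for g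
    using bij_betw_apply[OF bij that] .
  have U_sub: "U \<subseteq> carrier G" and V_sub: "V \<subseteq> carrier H"
    using U V by (auto dest: subgroup.subset)
  have image_act: "\<sigma> ` (X #>\<^bsub>G\<^esub> g) = \<sigma> ` X #>\<^bsub>H\<^esub> \<sigma> g"
    if "X \<subseteq> carrier G" "g \<in> carrier G" for X g
    using that hom by (force simp: r_coset_def hom_mult subset_iff)
  \<comment> \<open>Working with whole sets instead of coset representatives leaves no
    well-definedness to check.\<close>
  define \<mu> where "\<mu> X = y <#\<^bsub>H\<^esub> \<sigma> ` X" for X
  have \<mu>_coset: "\<mu> (U #>\<^bsub>G\<^esub> x) = V #>\<^bsub>H\<^esub> (y \<otimes>\<^bsub>H\<^esub> \<sigma> x)" if "x \<in> carrier G" for x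
  proof -
    have "\<mu> (U #>\<^bsub>G\<^esub> x) = y <#\<^bsub>H\<^esub> (inv\<^bsub>H\<^esub> y <#\<^bsub>H\<^esub> V #>\<^bsub>H\<^esub> y #>\<^bsub>H\<^esub> \<sigma> x)"
      using that U_sub by (simp add: \<mu>_def image_act conj)
    also have "\<dots> = y <#\<^bsub>H\<^esub> (inv\<^bsub>H\<^esub> y <#\<^bsub>H\<^esub> (V #>\<^bsub>H\<^esub> (y \<otimes>\<^bsub>H\<^esub> \<sigma> x)))"
      using y V_sub closed[OF that]
      by (simp add: H.l_coset_subset_G H.coset_mult_assoc H.coset_assoc)
    also have "\<dots> = V #>\<^bsub>H\<^esub> (y \<otimes>\<^bsub>H\<^esub> \<sigma> x)"
      using y V_sub closed[OF that]
      by (simp add: H.lcos_m_assoc H.lcos_mult_one H.r_coset_subset_G)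
    finally show ?thesis .
  qed
  have "bij_betw \<mu> (rcosets\<^bsub>G\<^esub> U) (rcosets\<^bsub>H\<^esub> V)"
  proof (rule bij_betw_imageI)
    show "inj_on \<mu> (rcosets\<^bsub>G\<^esub> U)"
    proof (rule inj_onI)
      fix X Y assume XY: "X \<in> rcosets\<^bsub>G\<^esub> U" "Y \<in> rcosets\<^bsub>G\<^esub> U" "\<mu> X = \<mu> Y"
      then have sub: "X \<subseteq> carrier G" "Y \<subseteq> carrier G"
        using subgroup.rcosets_carrier[OF U G.is_group] by auto
      \<comment> \<open>Undoing the left translation recovers \<sigma>(Z) from \<mu>(Z), and taking
        images under the injective \<sigma> is injective on subsets of the group.\<close>
      have "inv\<^bsub>H\<^esub> y <#\<^bsub>H\<^esub> \<mu> Z = \<sigma> ` Z" if "Z \<subseteq> carrier G" for Z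
      proof -
        have "\<sigma> ` Z \<subseteq> carrier H"
          using that closed by auto
        then show ?thesis
          using y by (simp add: \<mu>_def H.lcos_m_assoc H.lcos_mult_one)
      qed
      then have "\<sigma> ` X = \<sigma> ` Y"
        using XY sub by metis
      then show "X = Y"
        using inj_on_image_eq_iff[OF bij_betw_imp_inj_on[OF bij]] sub by blast
    qed
    \<comment> \<open>The representatives y \<sigma>(x) exhaust the group: take for \<open>x\<close>
      the preimage of y^-1 z. By \<open>\<mu>_coset\<close>, every coset of \<open>V\<close> is then
      attained.\<close>
    have "z \<in> (\<lambda>x. y \<otimes>\<^bsub>H\<^esub> \<sigma> x) ` carrier G" if z: "z \<in> carrier H" for z
    proof -
      have "inv\<^bsub>H\<^esub> y \<otimes>\<^bsub>H\<^esub> z \<in> \<sigma> ` carrier G"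
        using bij y z by (simp add: bij_betw_def)
      then obtain x where "x \<in> carrier G" "\<sigma> x = inv\<^bsub>H\<^esub> y \<otimes>\<^bsub>H\<^esub> z"
        by auto
      moreover have "z = y \<otimes>\<^bsub>H\<^esub> (inv\<^bsub>H\<^esub> y \<otimes>\<^bsub>H\<^esub> z)"
        using y z by (simp add: H.m_assoc[symmetric])
      ultimately show ?thesis by (metis imageI)
    qed
    then have onto: "(\<lambda>x. y \<otimes>\<^bsub>H\<^esub> \<sigma> x) ` carrier G = carrier H"
      using y closed by auto
    have "\<mu> ` (rcosets\<^bsub>G\<^esub> U) = (\<lambda>x. \<mu> (U #>\<^bsub>G\<^esub> x)) ` carrier G"
      by (auto simp: RCOSETS_def)
    also have "\<dots> = (\<lambda>z. V #>\<^bsub>H\<^esub> z) ` (\<lambda>x. y \<otimes>\<^bsub>H\<^esub> \<sigma> x) ` carrier G"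
      by (simp add: image_image \<mu>_coset)
    also have "\<dots> = rcosets\<^bsub>H\<^esub> V"
      unfolding onto by (auto simp: RCOSETS_def)
    finally show "\<mu> ` (rcosets\<^bsub>G\<^esub> U) = rcosets\<^bsub>H\<^esub> V" .
  qed
  moreover have "\<mu> (X #>\<^bsub>G\<^esub> g) = \<mu> X #>\<^bsub>H\<^esub> \<sigma> g"
    if "X \<in> rcosets\<^bsub>G\<^esub> U" "g \<in> carrier G" for X g
  proof -
    have sub: "X \<subseteq> carrier G"
      using that subgroup.rcosets_carrier[OF U G.is_group] by auto
    then have "\<sigma> ` X \<subseteq> carrier H"
      using closed by auto
    then show ?thesis
      using that sub y closed by (simp add: \<mu>_def image_act H.coset_assoc)
  qed
  ultimately show thesis
    using that by blast
qed

section \<open>Isomorphic maps and isomorphic groups: both directions combined\<close>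

theorem theorem5p2:
  fixes G :: "('a, 'c) monoid_scheme" and G' :: "('b, 'd) monoid_scheme"
  assumes "algebraic_map G U \<rho> \<tau>" and "algebraic_map G' U' \<rho>' \<tau>'"
  shows "map_isomorphic G U \<rho> \<tau> G' U' \<rho>' \<tau>' \<longleftrightarrow>
    (\<exists>\<sigma> \<in> iso G G'. \<exists>y \<in> carrier G'.
       \<sigma> ` U = inv\<^bsub>G'\<^esub> y <#\<^bsub>G'\<^esub> U' #>\<^bsub>G'\<^esub> y \<and> \<sigma> \<rho> = \<rho>' \<and> \<sigma> \<tau> = \<tau>')"
proof
  assume "map_isomorphic G U \<rho> \<tau> G' U' \<rho>' \<tau>'"
  then obtain \<mu> where \<mu>: "bij_betw \<mu> (rcosets\<^bsub>G\<^esub> U) (rcosets\<^bsub>G'\<^esub> U')"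
    and \<rho>: "\<And>X. X \<in> rcosets\<^bsub>G\<^esub> U \<Longrightarrow> \<mu> (X #>\<^bsub>G\<^esub> \<rho>) = \<mu> X #>\<^bsub>G'\<^esub> \<rho>'"
    and \<tau>: "\<And>X. X \<in> rcosets\<^bsub>G\<^esub> U \<Longrightarrow> \<mu> (X #>\<^bsub>G\<^esub> \<tau>) = \<mu> X #>\<^bsub>G'\<^esub> \<tau>'"
    unfolding map_isomorphic_iff_equivariant[OF assms] by blast
  show "\<exists>\<sigma> \<in> iso G G'. \<exists>y \<in> carrier G'.
       \<sigma> ` U = inv\<^bsub>G'\<^esub> y <#\<^bsub>G'\<^esub> U' #>\<^bsub>G'\<^esub> y \<and> \<sigma> \<rho> = \<rho>' \<and> \<sigma> \<tau> = \<tau>'"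
    by (rule iso_of_equivariant[OF assms \<mu>]) (use \<rho> \<tau> in blast)+
next
  interpret G: algebraic_map G U \<rho> \<tau> by fact
  interpret G': algebraic_map G' U' \<rho>' \<tau>' by fact
  assume "\<exists>\<sigma> \<in> iso G G'. \<exists>y \<in> carrier G'.
       \<sigma> ` U = inv\<^bsub>G'\<^esub> y <#\<^bsub>G'\<^esub> U' #>\<^bsub>G'\<^esub> y \<and> \<sigma> \<rho> = \<rho>' \<and> \<sigma> \<tau> = \<tau>'"
  then obtain \<sigma> y where \<sigma>: "\<sigma> \<in> iso G G'" "y \<in> carrier G'"
      "\<sigma> ` U = inv\<^bsub>G'\<^esub> y <#\<^bsub>G'\<^esub> U' #>\<^bsub>G'\<^esub> y" and gens: "\<sigma> \<rho> = \<rho>'" "\<sigma> \<tau> = \<tau>'"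
    by blast
  obtain \<mu> where \<mu>: "bij_betw \<mu> (rcosets\<^bsub>G\<^esub> U) (rcosets\<^bsub>G'\<^esub> U')"
    and equi: "\<And>X g. X \<in> rcosets\<^bsub>G\<^esub> U \<Longrightarrow> g \<in> carrier G \<Longrightarrow> \<mu> (X #>\<^bsub>G\<^esub> g) = \<mu> X #>\<^bsub>G'\<^esub> \<sigma> g"
    using equivariant_of_iso[OF G.is_group G'.is_group G.subgroup_U G'.subgroup_U \<sigma>] by blast
  \<comment> \<open>Equivariance holds for every group element; only its instances at the two
    generators, whose images under \<sigma> are \<rho>' and \<tau>', enter here.\<close>
  show "map_isomorphic G U \<rho> \<tau> G' U' \<rho>' \<tau>'"
    unfolding map_isomorphic_iff_equivariant[OF assms]
    using \<mu> equi[OF _ G.rho_closed] equi[OF _ G.tau_closed] gens by auto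
qed

end
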